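(* Let $\mathcal{H}$ be a real Hilbert space, $t_0>0$, and let $\Phi,U:\mathcal{H}\to\mathbb{R}$, $\gamma,\varepsilon:[t_0,+\infty)\to(0,+\infty)$ satisfy the standing assumptions listed in the context. Let $x\in C^2([t_0,+\infty);\mathcal{H})$ be a classical solution of $$x''(t)+\gamma(t)x'(t)+\nabla\Phi(x(t))+\varepsilon(t)\nabla U(x(t))=0,\qquad t\ge t_0.$$ Then $$\int_{t_0}^{+\infty}\gamma(t)\,\|x'(t)\|^2\,dt<+\infty,$$ and the energy function $$W(t)=\tfrac12\|x'(t)\|^2+\Phi(x(t))-\Phi^{*}+\varepsilon(t)\,(U(x(t))-U^{*})$$ converges to $0$ as $t\to+\infty$. In particular $\lim_{t\to+\infty}x'(t)=0$ and $\lim_{t\to+\infty}\Phi(x(t))=\Phi^{*}$.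
   Context: $\mathcal{H}$ is a real Hilbert space with inner product $\langle\cdot,\cdot\rangle$ and norm $\|\cdot\|$; $t_0>0$ is fixed. Standing assumptions: (1) $\Phi,U:\mathcal{H}\to\mathbb{R}$ are convex, continuously differentiable and bounded from below; $\Phi^{*}=\inf_{\mathcal{H}}\Phi$, $U^{*}=\inf_{\mathcal{H}}U$. (2) The set $S_\Phi=\operatorname{argmin}\Phi=\{z\in\mathcal{H}:\Phi(z)=\Phi^{*}\}$ is nonempty. (3) The gradients $\nabla\Phi$ and $\nabla U$ are Lipschitz on bounded subsets of $\mathcal{H}$. (4) $\gamma:[t_0,+\infty)\to(0,+\infty)$ is absolutely continuous and there exist $t_1\ge t_0$ and constants $K_1,K_2>0$ such that $\gamma(t)\ge K_1/t$ and $\gamma'(t)\le K_2/t^2$ for almost every $t\ge t_1$. (5) $\varepsilon:[t_0,+\infty)\to(0,+\infty)$ is absolutely continuous, nonincreasing, and $\lim_{t\to+\infty}\varepsilon(t)=0$. *)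

theory Defs
  imports "HOL-Analysis.Analysis"
begin

definition abs_continuous_between :: "real \<Rightarrow> real \<Rightarrow> (real \<Rightarrow> real) \<Rightarrow> bool" where
  "abs_continuous_between a b f \<longleftrightarrow>
     (\<forall>e>0. \<exists>d>0. \<forall>(n::nat) (l::nat \<Rightarrow> real) (r::nat \<Rightarrow> real).
        (\<forall>i<n. a \<le> l i \<and> l i \<le> r i \<and> r i \<le> b) \<and>
        disjoint_family_on (\<lambda>i. {l i<..<r i}) {..<n} \<and>
        (\<Sum>i<n. r i - l i) < d
        \<longrightarrow> (\<Sum>i<n. \<bar>f (r i) - f (l i)\<bar>) < e)"

text \<open>On an unbounded half-line, absolute continuity is understood on every compact
  subinterval, as is usual for coefficients of evolution equations.\<close>

definition abs_continuous_from :: "real \<Rightarrow> (real \<Rightarrow> real) \<Rightarrow> bool" where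
  "abs_continuous_from a f \<longleftrightarrow> (\<forall>b\<ge>a. abs_continuous_between a b f)"

definition lipschitz_on_bounded_sets :: "('a::metric_space \<Rightarrow> 'b::metric_space) \<Rightarrow> bool" where
  "lipschitz_on_bounded_sets g \<longleftrightarrow> (\<forall>B. bounded B \<longrightarrow> (\<exists>L. L-lipschitz_on B g))"

text \<open>The argument \<open>v\<close> stands for the velocity \<open>x'\<close>.\<close>

definition energy ::
  "('a::real_inner \<Rightarrow> real) \<Rightarrow> ('a \<Rightarrow> real) \<Rightarrow> (real \<Rightarrow> real) \<Rightarrow> (real \<Rightarrow> 'a) \<Rightarrow> (real \<Rightarrow> 'a) \<Rightarrow> real \<Rightarrow> real"
  where
  "energy \<Phi> U \<epsilon> x v t =
     1/2 * (norm (v t))\<^sup>2 + (\<Phi> (x t) - Inf (range \<Phi>)) + \<epsilon> t * (U (x t) - Inf (range U))"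

end

theory Submission
  imports Defs
begin

text \<open>The energy \<open>W\<close> decreases with \<open>W' \<le> - \<gamma> \<parallel>x'\<parallel>\<^sup>2\<close>, so \<open>\<gamma> \<parallel>x'\<parallel>\<^sup>2\<close> and hence \<open>\<parallel>x'\<parallel>\<^sup>2 / t\<close> are
  integrable. For a minimizer \<open>z\<close> of \<open>\<Phi>\<close> put \<open>h = \<parallel>x - z\<parallel>\<^sup>2 / 2\<close>; convexity gives
  \<open>h'' + \<gamma> h' \<le> 3/2 \<parallel>x'\<parallel>\<^sup>2 - W + \<epsilon> (U z - inf U)\<close>. Divide by \<open>t\<close> and integrate. A Hardy
  inequality bounds \<open>h / t\<^sup>2\<close> and \<open>\<integral> h / t\<^sup>3\<close>, and \<open>\<gamma> + K2 / t\<close> is nonincreasing, so the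
  second mean value theorem bounds \<open>\<integral> \<gamma> h' / t\<close> from below. If \<open>W\<close> stayed above some
  \<open>w > 0\<close>, then \<open>w ln t\<close> would be bounded.\<close>

section \<open>Monotonicity from an almost everywhere derivative bound\<close>

text \<open>The straddle estimate: since \<open>t\<close> lies between \<open>u\<close> and
  \<open>v\<close>, the linearization errors on the two sides add up to at most
  \<open>e * (v - u)\<close>. The radius depends on \<open>t\<close>, which is what a gauge
  allows.\<close>

lemma nonpos_derivative_gauge:
  fixes k :: "real \<Rightarrow> real"
  assumes "(k has_real_derivative D) (at t)" "D \<le> 0" "e > 0"
  shows "\<exists>d>0. \<forall>u v. u \<le> t \<and> t \<le> v \<and> {u..v} \<subseteq> ball t d \<longrightarrow> k v - k u \<le> e * (v - u)"
proof -
  obtain d where "d > 0"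
    and d: "\<And>y. norm (y - t) < d \<Longrightarrow> norm (k y - k t - D * (y - t)) \<le> e * norm (y - t)"
    using assms(1,3) unfolding has_field_derivative_def has_derivative_at_alt by metis
  have "k v - k u \<le> e * (v - u)" if "u \<le> t" "t \<le> v" "{u..v} \<subseteq> ball t d" for u v
  proof -
    have "u \<in> {u..v}" "v \<in> {u..v}" using that by auto
    then have "u \<in> ball t d" "v \<in> ball t d" using that by blast+
    then have "k v - k t \<le> D * (v - t) + e * (v - t)" "k t - k u \<le> D * (t - u) + e * (t - u)"
      using d[of v] d[of u] that by (auto simp: dist_real_def abs_le_iff algebra_simps)
    moreover have "D * (v - t) \<le> 0" "D * (t - u) \<le> 0"
      using that assms(2) by (auto simp: mult_nonpos_nonneg)
    ultimately show ?thesis by (simp add: algebra_simps)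
  qed
  with \<open>d > 0\<close> show ?thesis by blast
qed

text \<open>The interiors of the division intervals are pairwise disjoint and contained in
  \<open>G\<close>, so by finite additivity their total length is at most the measure of
  \<open>G\<close>.\<close>

lemma tagged_partial_division_sum_length_le:
  fixes p :: "(real \<times> real set) set"
  assumes p: "p tagged_partial_division_of {a..b}" and G: "\<And>x K. (x, K) \<in> p \<Longrightarrow> K \<subseteq> G" "open G"
    and meas: "emeasure lborel G < ennreal d"
  shows "(\<Sum>(x, K)\<in>p. Sup K - Inf K) < d"
proof -
  note pD = tagged_partial_division_ofD[OF p]
  let ?I = "\<lambda>(x::real, K::real set). interior K"
  have K: "interior K = {Inf K<..<Sup K} \<and> Inf K \<le> Sup K" if "(x, K) \<in> p" for x K
  proof -
    obtain u v where "K = {u..v}" using pD(4)[OF \<open>(x, K) \<in> p\<close>] by auto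
    moreover have "u \<le> v" using pD(2)[OF \<open>(x, K) \<in> p\<close>] calculation by auto
    ultimately show ?thesis by auto
  qed
  have dis: "disjoint_family_on ?I p"
    unfolding disjoint_family_on_def using pD(5) by fastforce
  have "(\<Sum>i\<in>p. measure lborel (?I i)) = measure lborel (\<Union>i\<in>p. ?I i)"
    by (rule measure_finite_Union[symmetric, OF pD(1) _ dis]) (auto simp: K)
  also have "\<dots> \<le> measure lborel G"
  proof (rule measure_mono_fmeasurable)
    show "(\<Union>i\<in>p. ?I i) \<subseteq> G" using G(1) interior_subset by fastforce
    show "G \<in> fmeasurable lborel" using meas \<open>open G\<close>
      by (auto simp: fmeasurable_def less_top[symmetric] dest: less_trans)
    show "(\<Union>i\<in>p. ?I i) \<in> sets lborel"
      using pD(1) by (auto intro!: sets.finite_UN)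
  qed
  also have "\<dots> < d"
    using meas by (metis emeasure_eq_ennreal_measure ennreal_less_iff leD linear measure_nonneg top_greatest)
  also have "(\<Sum>i\<in>p. measure lborel (?I i)) = (\<Sum>(x, K)\<in>p. Sup K - Inf K)"
    using K by (auto intro!: sum.cong)
  finally show ?thesis .
qed

text \<open>Carries the defining condition of absolute continuity, phrased for indexed families of
  intervals, over to sums over a tagged partial division by enumerating the division.\<close>

lemma abs_continuous_between_division:
  fixes p :: "(real \<times> real set) set"
  assumes d: "\<And>(n::nat) l r. \<lbrakk>\<forall>i<n. a \<le> l i \<and> l i \<le> r i \<and> r i \<le> b;
       disjoint_family_on (\<lambda>i. {l i<..<r i}) {..<n}; (\<Sum>i<n. r i - l i) < d\<rbrakk>
       \<Longrightarrow> (\<Sum>i<n. \<bar>f (r i) - f (l i)\<bar>) < e"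
    and p: "p tagged_partial_division_of {a..b}" and len: "(\<Sum>(x, K)\<in>p. Sup K - Inf K) < d"
  shows "(\<Sum>(x, K)\<in>p. \<bar>f (Sup K) - f (Inf K)\<bar>) < (e::real)"
proof -
  note pD = tagged_partial_division_ofD[OF p]
  have K: "interior K = {Inf K<..<Sup K} \<and> Inf K \<le> Sup K \<and> a \<le> Inf K \<and> Sup K \<le> b"
    if "(x, K) \<in> p" for x K
  proof -
    obtain u v where "K = {u..v}" using pD(4)[OF \<open>(x, K) \<in> p\<close>] by auto
    moreover have "u \<le> v" using pD(2)[OF \<open>(x, K) \<in> p\<close>] calculation by auto
    ultimately show ?thesis using pD(3)[OF that] by auto
  qed
  obtain n :: nat and h where "bij_betw h {..<n} p"
    using ex_bij_betw_nat_finite[OF pD(1)] by (auto simp: atLeast0LessThan)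
  then have h: "inj_on h {..<n}" "\<And>i. i < n \<Longrightarrow> h i \<in> p" and reindex: "\<And>F::_\<Rightarrow>real. sum F p = (\<Sum>i<n. F (h i))"
    by (auto simp: bij_betw_def sum.reindex)
  show ?thesis unfolding reindex case_prod_unfold
  proof (rule d)
    show "\<forall>i<n. a \<le> Inf (snd (h i)) \<and> Inf (snd (h i)) \<le> Sup (snd (h i)) \<and> Sup (snd (h i)) \<le> b"
      using K h(2) by (metis prod.collapse)
    show "(\<Sum>i<n. Sup (snd (h i)) - Inf (snd (h i))) < d"
      using len unfolding reindex case_prod_unfold .
    show "disjoint_family_on (\<lambda>i. {Inf (snd (h i))<..<Sup (snd (h i))}) {..<n}"
      unfolding disjoint_family_on_def
    proof (intro ballI impI)
      fix i j assume "i \<in> {..<n}" "j \<in> {..<n}" "i \<noteq> j"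
      then have "h i \<noteq> h j" "h i \<in> p" "h j \<in> p" using h by (auto simp: inj_on_def)
      then show "{Inf (snd (h i))<..<Sup (snd (h i))} \<inter> {Inf (snd (h j))<..<Sup (snd (h j))} = {}"
        using K pD(5) by (metis prod.collapse)
    qed
  qed
qed

text \<open>On a fine tagged division, the intervals tagged outside the exceptional null set are
  controlled by the derivative and the remaining ones, of small total length, by absolute
  continuity; there \<open>g\<close> may be dropped because it is monotone.\<close>

lemma abs_continuous_between_AE_deriv_le:
  assumes "a \<le> b" and AC: "abs_continuous_between a b f" and g: "mono_on {a..b} g"
    and AE: "AE t in lborel. t \<in> {a..b} \<longrightarrow> (\<exists>D\<le>0. ((\<lambda>t. f t - g t) has_real_derivative D) (at t))"
  shows "f b - g b \<le> f a - g a"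
proof (rule field_le_epsilon)
  fix e0 :: real assume "e0 > 0"
  \<comment> \<open>With this choice \<open>e * (b - a)\<close> pays for the intervals tagged
    outside the null set and one further \<open>e\<close> for all the others together.\<close>
  define e where "e = e0 / (b - a + 1)"
  have "e > 0" and e: "e * (b - a) + e = e0"
    using \<open>e0 > 0\<close> \<open>a \<le> b\<close> by (auto simp: e_def divide_simps) (simp add: algebra_simps)
  define k where "k = (\<lambda>t. f t - g t)"
  obtain N where "N \<in> null_sets lborel"
    "{t \<in> space lborel. \<not> (t \<in> {a..b} \<longrightarrow> (\<exists>D\<le>0. (k has_real_derivative D) (at t)))} \<subseteq> N"
    using AE unfolding eventually_ae_filter k_def by blast
  then have N: "N \<in> null_sets lborel"
    "\<And>t. \<lbrakk>t \<in> {a..b}; t \<notin> N\<rbrakk> \<Longrightarrow> \<exists>D\<le>0. (k has_real_derivative D) (at t)"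
    by auto
  obtain d where "d > 0" and d: "\<And>(n::nat) l r. \<lbrakk>\<forall>i<n. a \<le> l i \<and> l i \<le> r i \<and> r i \<le> b;
       disjoint_family_on (\<lambda>i. {l i<..<r i}) {..<n}; (\<Sum>i<n. r i - l i) < d\<rbrakk>
       \<Longrightarrow> (\<Sum>i<n. \<bar>f (r i) - f (l i)\<bar>) < e"
    using AC[unfolded abs_continuous_between_def, rule_format, OF \<open>e > 0\<close>] by blast
  \<comment> \<open>Outer regularity encloses the exceptional null set in an open set whose measure
    is below the \<open>d\<close> of absolute continuity.\<close>
  obtain G where G: "open G" "N \<subseteq> G" "emeasure lborel (G - N) < ennreal d"
    using outer_regular_lborel[of N d] null_setsD2[OF N(1)] \<open>d > 0\<close> by (metis sets_lborel)
  have Gd: "emeasure lborel G < ennreal d"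
    using G emeasure_Diff_null_set[OF N(1), of G] by simp
  \<comment> \<open>The gauge: balls around exceptional points stay inside \<open>G\<close>, and
    balls around the other points of the interval are small enough for the straddle
    estimate.\<close>
  have "\<exists>r. 0 < r \<and> (t \<in> N \<longrightarrow> ball t r \<subseteq> G) \<and> (t \<notin> N \<and> t \<in> {a..b} \<longrightarrow>
      (\<forall>u v. u \<le> t \<and> t \<le> v \<and> {u..v} \<subseteq> ball t r \<longrightarrow> k v - k u \<le> e * (v - u)))" for t
  proof (cases "t \<in> N")
    case True
    then obtain r where "0 < r" "ball t r \<subseteq> G" using G(1,2) by (meson openE subsetD)
    then show ?thesis using True by blast
  next
    case False
    show ?thesis
    proof (cases "t \<in> {a..b}")
      case True
      obtain D where D: "(k has_real_derivative D) (at t)" "D \<le> 0" using N(2) True False by blast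
      from nonpos_derivative_gauge[OF D \<open>e > 0\<close>] show ?thesis using False by auto
    qed (use False in \<open>auto intro: exI[of _ 1]\<close>)
  qed
  then obtain r where r: "\<And>t. 0 < r t \<and> (t \<in> N \<longrightarrow> ball t (r t) \<subseteq> G) \<and> (t \<notin> N \<and> t \<in> {a..b} \<longrightarrow>
      (\<forall>u v. u \<le> t \<and> t \<le> v \<and> {u..v} \<subseteq> ball t (r t) \<longrightarrow> k v - k u \<le> e * (v - u)))"
    by (rule choice[OF allI, THEN exE]) (rule that, erule spec)
  have "gauge (\<lambda>t. ball t (r t))" using r by (simp add: gauge_def)
  then obtain p where p: "p tagged_division_of {a..b}" and fine: "(\<lambda>t. ball t (r t)) fine p"
    using fine_division_exists_real by blast
  note pD = tagged_division_ofD[OF p]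
  define q where "q = {(x, K) \<in> p. x \<in> N}"
  have "q \<subseteq> p" by (auto simp: q_def)
  then have q: "q tagged_partial_division_of {a..b}"
    using p tagged_partial_division_subset unfolding tagged_division_of_def by blast
  have K: "\<exists>u v. K = {u..v} \<and> u \<le> x \<and> x \<le> v \<and> a \<le> u \<and> v \<le> b \<and> {u..v} \<subseteq> ball x (r x)"
    if xK: "(x, K) \<in> p" for x K
  proof -
    obtain u v where uv: "K = {u..v}" using pD(4)[OF xK] by auto
    moreover have "u \<le> x" "x \<le> v" using pD(2)[OF xK] uv by auto
    moreover have "a \<le> u" "v \<le> b" using pD(3)[OF xK] uv calculation by auto
    ultimately show ?thesis using fineD[OF fine xK] by blast
  qed
  have "(\<Sum>(x, K)\<in>q. Sup K - Inf K) < d"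
  proof (rule tagged_partial_division_sum_length_le[OF q _ G(1) Gd])
    fix x K assume "(x, K) \<in> q"
    then show "K \<subseteq> G" using fineD[OF fine, of x K] r[of x] by (auto simp: q_def)
  qed
  then have small: "(\<Sum>(x, K)\<in>q. \<bar>f (Sup K) - f (Inf K)\<bar>) < e"
    using abs_continuous_between_division[OF d q] by simp
  have "k b - k a = (\<Sum>(x, K)\<in>p. k (Sup K) - k (Inf K))"
    using additive_tagged_division_1[OF \<open>a \<le> b\<close> p, of k] by simp
  also have "\<dots> \<le> (\<Sum>(x, K)\<in>p. e * (Sup K - Inf K) + (if (x, K) \<in> q then \<bar>f (Sup K) - f (Inf K)\<bar> else 0))"
  proof (rule sum_mono, clarify)
    fix x K assume xK: "(x, K) \<in> p"
    then obtain u v where uv: "K = {u..v}" "u \<le> x" "x \<le> v" "a \<le> u" "v \<le> b" "{u..v} \<subseteq> ball x (r x)"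
      using K by blast
    then have [simp]: "Sup K = v" "Inf K = u" by auto
    have "k v - k u \<le> e * (v - u) + (if (x, K) \<in> q then \<bar>f v - f u\<bar> else 0)"
    proof (cases "x \<in> N")
      case True
      have "g u \<le> g v" using uv by (intro mono_onD[OF g]) auto
      moreover have "0 \<le> e * (v - u)" using uv \<open>e > 0\<close> by simp
      ultimately show ?thesis using True xK unfolding q_def k_def by auto
    next
      case False
      then show ?thesis using r[of x] uv by (auto simp: q_def)
    qed
    then show "k (Sup K) - k (Inf K) \<le> e * (Sup K - Inf K) + (if (x, K) \<in> q then \<bar>f (Sup K) - f (Inf K)\<bar> else 0)"
      by (simp split: if_splits)
  qed
  also have "\<dots> = e * (\<Sum>(x, K)\<in>p. Sup K - Inf K) + (\<Sum>(x, K)\<in>q. \<bar>f (Sup K) - f (Inf K)\<bar>)"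
    using \<open>q \<subseteq> p\<close> pD(1)
    by (simp add: sum.distrib sum_distrib_left case_prod_unfold sum.If_cases Int_absorb1 Int_absorb2)
  also have "(\<Sum>(x, K)\<in>p. Sup K - Inf K) = b - a"
    using additive_tagged_division_1[OF \<open>a \<le> b\<close> p, of "\<lambda>x. x"] by simp
  also have "e * (b - a) + (\<Sum>(x, K)\<in>q. \<bar>f (Sup K) - f (Inf K)\<bar>) \<le> e0"
    using small e by linarith
  finally show "f b - g b \<le> f a - g a + e0" by (simp add: k_def)
qed

section \<open>Pointwise consequences of absolute continuity and of almost everywhere bounds\<close>

text \<open>A family consisting of the single interval between \<open>s\<close> and \<open>t\<close>
  turns the definition into the usual condition for continuity.\<close>

lemma abs_continuous_between_continuous_on:
  assumes "abs_continuous_between a b f"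
  shows "continuous_on {a..b} f"
  unfolding continuous_on_iff
proof (intro ballI allI impI)
  fix s e :: real assume s: "s \<in> {a..b}" and "e > 0"
  then obtain d where "d > 0" and d: "\<And>(n::nat) l r. \<lbrakk>\<forall>i<n. a \<le> l i \<and> l i \<le> r i \<and> r i \<le> b;
       disjoint_family_on (\<lambda>i. {l i<..<r i}) {..<n}; (\<Sum>i<n. r i - l i) < d\<rbrakk>
       \<Longrightarrow> (\<Sum>i<n. \<bar>f (r i) - f (l i)\<bar>) < e"
    using assms[unfolded abs_continuous_between_def, rule_format, OF \<open>e > 0\<close>] by blast
  have "dist (f t) (f s) < e" if t: "t \<in> {a..b}" "dist t s < d" for t
    using d[of "Suc 0" "\<lambda>_. min s t" "\<lambda>_. max s t"] s t
    by (auto simp: dist_real_def disjoint_family_on_def min_def max_def abs_if split: if_splits)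
  then show "\<exists>d>0. \<forall>t\<in>{a..b}. dist t s < d \<longrightarrow> dist (f t) (f s) < e"
    using \<open>d > 0\<close> by blast
qed

lemma abs_continuous_from_continuous_on:
  assumes "abs_continuous_from a f"
  shows "continuous_on {a..} f"
proof -
  have "continuous (at t within {a..}) f" if "t \<ge> a" for t
  proof -
    have "continuous_on {a..t + 1} f"
      using assms that abs_continuous_between_continuous_on by (simp add: abs_continuous_from_def)
    then have "continuous (at t within {a..t + 1}) f"
      using that by (simp add: continuous_on_eq_continuous_within)
    moreover have "at t within {a..t + 1} = at t within {a..}"
      by (rule at_within_nhd[of _ "{..<t + 1}"]) auto
    ultimately show ?thesis by simp
  qed
  then show ?thesis by (simp add: continuous_on_eq_continuous_within)
qed

lemma abs_continuous_between_subinterval: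
  assumes "abs_continuous_between a b f" "a \<le> c" "d \<le> b"
  shows "abs_continuous_between c d f"
  unfolding abs_continuous_between_def
proof (intro allI impI)
  fix e :: real assume "e > 0"
  then obtain m where "m > 0" and m: "\<And>(n::nat) l r. \<lbrakk>\<forall>i<n. a \<le> l i \<and> l i \<le> r i \<and> r i \<le> b;
       disjoint_family_on (\<lambda>i. {l i<..<r i}) {..<n}; (\<Sum>i<n. r i - l i) < m\<rbrakk>
       \<Longrightarrow> (\<Sum>i<n. \<bar>f (r i) - f (l i)\<bar>) < e"
    using assms(1)[unfolded abs_continuous_between_def, rule_format, OF \<open>e > 0\<close>] by blast
  have "(\<Sum>i<n. \<bar>f (r i) - f (l i)\<bar>) < e"
    if "\<forall>i<n. c \<le> l i \<and> l i \<le> r i \<and> r i \<le> d" "disjoint_family_on (\<lambda>i. {l i<..<r i}) {..<n}"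
      "(\<Sum>i<n. r i - l i) < m" for n :: nat and l r :: "nat \<Rightarrow> real"
  proof (rule m)
    show "\<forall>i<n. a \<le> l i \<and> l i \<le> r i \<and> r i \<le> b"
      using that(1) assms(2,3) by force
  qed (use that in auto)
  then show "\<exists>m>0. \<forall>(n::nat) (l::nat \<Rightarrow> real) (r::nat \<Rightarrow> real).
        (\<forall>i<n. c \<le> l i \<and> l i \<le> r i \<and> r i \<le> d) \<and>
        disjoint_family_on (\<lambda>i. {l i<..<r i}) {..<n} \<and>
        (\<Sum>i<n. r i - l i) < m
        \<longrightarrow> (\<Sum>i<n. \<bar>f (r i) - f (l i)\<bar>) < e"
    using \<open>m > 0\<close> by blast
qed

text \<open>The part of the open ray where \<open>f\<close> is negative is open and null, and a
  nonempty open set is not negligible. This turns the almost everywhere lower bound on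
  \<open>\<gamma>\<close> into a pointwise one.\<close>

lemma AE_continuous_imp_nonneg:
  fixes f :: "real \<Rightarrow> real"
  assumes "AE t in lborel. a \<le> t \<longrightarrow> 0 \<le> f t" "continuous_on {a<..} f" "a < t"
  shows "0 \<le> f t"
proof (rule ccontr)
  assume "\<not> 0 \<le> f t"
  define S where "S = {a<..} \<inter> f -` {..<0}"
  have "open S"
    unfolding S_def by (rule continuous_open_preimage[OF assms(2)]) auto
  have "t \<in> S" using \<open>\<not> 0 \<le> f t\<close> \<open>a < t\<close> by (auto simp: S_def)
  have "AE t in lborel. t \<notin> S"
    using assms(1) by eventually_elim (auto simp: S_def)
  then have "S \<in> null_sets lborel"
    using \<open>open S\<close> by (subst AE_iff_null_sets) auto
  then have "negligible S"
    by (simp add: negligible_iff_null_sets null_sets_completionI)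
  then show False using open_not_negligible[OF \<open>open S\<close>] \<open>t \<in> S\<close> by auto
qed

section \<open>Calculus on half-lines\<close>

lemma has_real_derivative_integral_atLeast:
  fixes f :: "real \<Rightarrow> real"
  assumes "continuous_on {a..} f" "a \<le> t"
  shows "((\<lambda>t. integral {a..t} f) has_real_derivative f t) (at t within {a..})"
proof -
  have "((\<lambda>t. integral {a..t} f) has_real_derivative f t) (at t within {a..t + 1})"
    using assms by (intro integral_has_real_derivative continuous_on_subset[OF assms(1)]) auto
  moreover have "at t within {a..t + 1} = at t within {a..}"
    by (rule at_within_nhd[of _ "{..<t + 1}"]) auto
  ultimately show ?thesis by simp
qed

lemma nonpos_derivative_imp_le:
  fixes f :: "real \<Rightarrow> real"
  assumes "\<And>s. a \<le> s \<Longrightarrow> (f has_real_derivative f' s) (at s within {a..})"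
    and "\<And>s. a \<le> s \<Longrightarrow> f' s \<le> 0" and "a \<le> t"
  shows "f t \<le> f a"
proof -
  have "(f has_derivative (*) (f' s)) (at s within {a..t})" if "a \<le> s" "s \<le> t" for s
    using has_field_derivative_imp_has_derivative[OF assms(1)[OF that(1)]]
    by (rule has_derivative_subset) auto
  then obtain s where "s \<in> {a..t}" "f t - f a = f' s * (t - a)"
    using mvt_very_simple[OF \<open>a \<le> t\<close>, of f "\<lambda>s. (*) (f' s)"] by blast
  then show ?thesis
    using assms(2)[of s] \<open>a \<le> t\<close> mult_nonpos_nonneg[of "f' s" "t - a"] by auto
qed

text \<open>Replaces integration by parts for weights that are only monotone.\<close>

lemma antimono_weight_integral:
  fixes u q :: "real \<Rightarrow> real"
  assumes "a \<le> b" and u: "\<And>t. t \<in> {a..b} \<Longrightarrow> (u has_real_derivative u' t) (at t within {a..b})"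
    and u_nonneg: "\<And>t. t \<in> {a..b} \<Longrightarrow> 0 \<le> u t" and q: "antimono_on {a..b} q"
  shows "(\<lambda>t. q t * u' t) integrable_on {a..b}"
    and "q b * u b - q a * u a \<le> integral {a..b} (\<lambda>t. q t * u' t)"
proof -
  have FTC: "(u' has_integral u d - u c) {c..d}" if "a \<le> c" "c \<le> d" "d \<le> b" for c d
  proof (rule fundamental_theorem_of_calculus[OF that(2)])
    show "(u has_vector_derivative u' t) (at t within {c..d})" if "t \<in> {c..d}" for t
      using DERIV_subset[OF u, of t "{c..d}"] that \<open>a \<le> c\<close> \<open>d \<le> b\<close>
      by (auto simp flip: has_real_derivative_iff_has_vector_derivative)
  qed
  \<comment> \<open>The second mean value theorem is stated for nondecreasing weights, hence the
    passage to \<open>- q\<close>.\<close>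
  obtain c where c: "c \<in> {a..b}" "((\<lambda>t. - q t * u' t) has_integral
      (- q a * integral {a..c} u' + - q b * integral {c..b} u')) {a..b}"
  proof (rule second_mean_value_theorem_full[of u' a b "\<lambda>t. - q t"])
    show "- q s \<le> - q t" if "a \<le> s" "s \<le> t" "t \<le> b" for s t
      using that monotone_onD[OF q, of s t] by auto
  qed (use FTC[of a b] \<open>a \<le> b\<close> in auto)
  then have "((\<lambda>t. - q t * u' t) has_integral (- q a * (u c - u a) + - q b * (u b - u c))) {a..b}"
    using FTC[of a c] FTC[of c b] by (simp add: integral_unique)
  from has_integral_neg[OF this]
  have int: "((\<lambda>t. q t * u' t) has_integral (q a * (u c - u a) + q b * (u b - u c))) {a..b}"
    by (simp add: algebra_simps)
  then show "(\<lambda>t. q t * u' t) integrable_on {a..b}" by auto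
  \<comment> \<open>This product is exactly the difference between the integral and
    \<open>q b * u b - q a * u a\<close>.\<close>
  have "0 \<le> (q a - q b) * u c"
    using monotone_onD[OF q, of a b] \<open>a \<le> b\<close> u_nonneg[OF c(1)] by auto
  then show "q b * u b - q a * u a \<le> integral {a..b} (\<lambda>t. q t * u' t)"
    using integral_unique[OF int] by (simp add: algebra_simps)
qed

section \<open>Gradients, convexity and improper integrals\<close>

lemma GDERIV_chain_vector_derivative:
  assumes "GDERIV f (x t) :> g" "(x has_vector_derivative v) (at t within S)"
  shows "((\<lambda>t. f (x t)) has_real_derivative inner v g) (at t within S)"
proof -
  have "(f \<circ> x has_derivative (\<lambda>h. inner h g) \<circ> (\<lambda>h. h *\<^sub>R v)) (at t within S)"
    using assms unfolding gderiv_def has_vector_derivative_def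
    by (intro diff_chain_within) (auto intro: has_derivative_at_withinI)
  then show ?thesis
    by (simp add: has_field_derivative_def o_def mult.commute[of _ "inner v g"])
qed

text \<open>Restricting \<open>f\<close> to the line through \<open>y\<close> and \<open>z\<close>
  reduces the claim to the tangent inequality at 0 for a convex function of one real
  variable.\<close>

lemma convex_on_gradient_ineq:
  fixes f :: "'a::real_inner \<Rightarrow> real"
  assumes f: "convex_on UNIV f" and g: "GDERIV f y :> g"
  shows "f y + inner (z - y) g \<le> f z"
proof -
  define \<phi> where "\<phi> = (\<lambda>s. f (y + s *\<^sub>R (z - y)))"
  have "convex_on UNIV \<phi>"
  proof (rule convex_onI)
    fix t s r :: real assume t: "0 < t" "t < 1"
    have "y + ((1 - t) * s + t * r) *\<^sub>R (z - y) = (1 - t) *\<^sub>R (y + s *\<^sub>R (z - y)) + t *\<^sub>R (y + r *\<^sub>R (z - y))"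
      by (simp add: algebra_simps)
    then show "\<phi> ((1 - t) *\<^sub>R s + t *\<^sub>R r) \<le> (1 - t) * \<phi> s + t * \<phi> r"
      unfolding \<phi>_def using convex_onD[OF f, of t] t by simp
  qed auto
  moreover have "(\<phi> has_real_derivative inner (z - y) g) (at 0)"
    unfolding \<phi>_def
  proof (rule GDERIV_chain_vector_derivative)
    show "((\<lambda>s. y + s *\<^sub>R (z - y)) has_vector_derivative z - y) (at 0)"
      by (auto intro!: derivative_eq_intros)
  qed (use g in simp)
  ultimately have "inner (z - y) g * (1 - 0) \<le> \<phi> 1 - \<phi> 0"
    by (intro convex_on_imp_above_tangent[of UNIV]) auto
  then show ?thesis by (simp add: \<phi>_def)
qed

text \<open>Monotone convergence along the intervals from \<open>a\<close> to \<open>a + n\<close>,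
  on each of which the extended integral equals the gauge integral and is bounded by
  \<open>C\<close>.\<close>

lemma nn_integral_atLeast_finite:
  fixes f :: "real \<Rightarrow> real"
  assumes cont: "continuous_on {a..} f" and nonneg: "\<And>t. a \<le> t \<Longrightarrow> 0 \<le> f t"
    and bound: "\<And>t. a \<le> t \<Longrightarrow> integral {a..t} f \<le> C"
  shows "(\<integral>\<^sup>+t\<in>{a..}. ennreal (f t) \<partial>lborel) < \<infinity>"
proof -
  have "(\<integral>\<^sup>+t. ennreal (f t) * indicator {a..} t \<partial>lborel) =
      (SUP n::nat. \<integral>\<^sup>+t. ennreal (f t) * indicator {a..a + real n} t \<partial>lborel)"
  proof (subst nn_integral_monotone_convergence_SUP[symmetric])
    show "incseq (\<lambda>n t. ennreal (f t) * indicator {a..a + real n} t)"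
      by (auto simp: mono_def le_fun_def indicator_def)
    have "(\<lambda>t. indicator {a..a + real n} t *\<^sub>R f t) \<in> borel_measurable borel" for n
      by (intro borel_measurable_continuous_on_indicator continuous_on_subset[OF cont]) auto
    from measurable_compose[OF this measurable_ennreal]
    have "(\<lambda>t. ennreal (indicator {a..a + real n} t *\<^sub>R f t)) \<in> borel_measurable borel" for n .
    moreover have "ennreal (indicator {a..a + real n} t *\<^sub>R f t) = ennreal (f t) * indicator {a..a + real n} t" for n t
      by (simp add: indicator_def)
    ultimately show "(\<lambda>t. ennreal (f t) * indicator {a..a + real n} t) \<in> borel_measurable lborel" for n
      by simp
    have "ennreal (f t) * indicator {a..} t = (SUP n. ennreal (f t) * indicator {a..a + real n} t)" for t
    proof (cases "a \<le> t")
      case True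
      obtain n :: nat where "t \<le> a + real n" using real_arch_simple[of "t - a"] by (auto simp: algebra_simps)
      then have "ennreal (f t) * indicator {a..} t \<le> (SUP n. ennreal (f t) * indicator {a..a + real n} t)"
        using True by (intro SUP_upper2[of n]) auto
      then show ?thesis by (intro antisym SUP_least) (auto simp: indicator_def)
    qed auto
    then show "(\<integral>\<^sup>+t. ennreal (f t) * indicator {a..} t \<partial>lborel) =
      (\<integral>\<^sup>+t. (SUP n. ennreal (f t) * indicator {a..a + real n} t) \<partial>lborel)"
      by simp
  qed
  also have "\<dots> \<le> ennreal C"
  proof (rule SUP_least)
    fix n :: nat
    have "(f has_integral integral {a..a + real n} f) {a..a + real n}"
      by (intro integrable_integral integrable_continuous_interval continuous_on_subset[OF cont]) auto
    then have "(\<integral>\<^sup>+t. ennreal (f t) * indicator {a..a + real n} t \<partial>lborel) = ennreal (integral {a..a + real n} f)"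
      using nonneg by (intro nn_integral_has_integral_lebesgue') auto
    then show "(\<integral>\<^sup>+t. ennreal (f t) * indicator {a..a + real n} t \<partial>lborel) \<le> ennreal C"
      using bound[of "a + real n"] by (simp add: ennreal_leI)
  qed
  also have "\<dots> < \<infinity>" by simp
  finally show ?thesis .
qed

section \<open>The energy and its dissipation\<close>

locale inertial_gradient_system =
  fixes \<Phi> U :: "'a::real_inner \<Rightarrow> real"
    and grad\<Phi> gradU :: "'a \<Rightarrow> 'a"
    and \<gamma> \<epsilon> :: "real \<Rightarrow> real"
    and x x' x'' :: "real \<Rightarrow> 'a"
    and t0 :: real
  assumes t0: "t0 > 0"
    and convex: "convex_on UNIV \<Phi>" "convex_on UNIV U"
    and gradient: "\<And>z. GDERIV \<Phi> z :> grad\<Phi> z" "\<And>z. GDERIV U z :> gradU z"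
    and bounded_below: "bdd_below (range \<Phi>)" "bdd_below (range U)"
    and \<gamma>_pos: "\<And>t. t \<ge> t0 \<Longrightarrow> \<gamma> t > 0"
    and \<gamma>_cont: "continuous_on {t0..} \<gamma>"
    and \<epsilon>_pos: "\<And>t. t \<ge> t0 \<Longrightarrow> \<epsilon> t > 0"
    and \<epsilon>_antimono: "antimono_on {t0..} \<epsilon>"
    and x_deriv: "\<And>t. t \<ge> t0 \<Longrightarrow> (x has_vector_derivative x' t) (at t within {t0..})"
    and x'_deriv: "\<And>t. t \<ge> t0 \<Longrightarrow> (x' has_vector_derivative x'' t) (at t within {t0..})"
    and ode: "\<And>t. t \<ge> t0 \<Longrightarrow>
          x'' t + \<gamma> t *\<^sub>R x' t + grad\<Phi> (x t) + \<epsilon> t *\<^sub>R gradU (x t) = 0"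
begin

abbreviation "W \<equiv> energy \<Phi> U \<epsilon> x x'"

abbreviation dissipation :: "real \<Rightarrow> real" where
  "dissipation t \<equiv> \<gamma> t * (norm (x' t))\<^sup>2"

lemma \<Phi>_ge_Inf: "Inf (range \<Phi>) \<le> \<Phi> z" and U_ge_Inf: "Inf (range U) \<le> U z"
  using bounded_below by (auto intro: cInf_lower)

lemma continuous_x: "continuous_on {t0..} x" and continuous_x': "continuous_on {t0..} x'"
  using x_deriv x'_deriv by (auto intro!: continuous_on_vector_derivative)

lemma continuous_dissipation: "continuous_on {t0..} dissipation"
  by (intro continuous_intros \<gamma>_cont continuous_x')

lemma dissipation_nonneg: "t0 \<le> t \<Longrightarrow> 0 \<le> dissipation t"
  using \<gamma>_pos[of t] by simp

lemma energy_lower_bounds: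
  assumes "t0 \<le> t"
  shows "(norm (x' t))\<^sup>2 / 2 \<le> W t" "\<Phi> (x t) - Inf (range \<Phi>) \<le> W t"
proof -
  have "0 \<le> \<epsilon> t * (U (x t) - Inf (range U))"
    using \<epsilon>_pos[OF assms] U_ge_Inf by simp
  then show "(norm (x' t))\<^sup>2 / 2 \<le> W t" "\<Phi> (x t) - Inf (range \<Phi>) \<le> W t"
    using \<Phi>_ge_Inf[of "x t"] zero_le_power2[of "norm (x' t)"] by (simp_all add: energy_def)
qed

lemma energy_nonneg: "t0 \<le> t \<Longrightarrow> 0 \<le> W t"
  using energy_lower_bounds(1)[of t] zero_le_power2[of "norm (x' t)"] by linarith

text \<open>Formally \<open>W' = - dissipation + \<epsilon>' * (U (x t) - Inf (range U))\<close>,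
  and the last term is nonpositive. The integrated form avoids \<open>\<epsilon>'\<close>:
  monotonicity of \<open>\<epsilon>\<close> and nonnegativity of the gap in \<open>U\<close> suffice
  for the weighted integral inequality.\<close>

lemma energy_dissipation:
  assumes "t0 \<le> s" "s \<le> t"
  shows "W t + integral {s..t} dissipation \<le> W s"
proof -
  define u where "u = (\<lambda>r. U (x r) - Inf (range U))"
  define u' where "u' = (\<lambda>r. inner (x' r) (gradU (x r)))"
  \<comment> \<open>Up to an additive constant, \<open>Z\<close> is the energy without its
    \<open>U\<close> term. Its derivative contains \<open>\<epsilon>\<close> but not
    \<open>\<epsilon>'\<close>.\<close>
  define Z where "Z = (\<lambda>r. inner (x' r) (x' r) / 2 + \<Phi> (x r))"
  have u: "(u has_real_derivative u' r) (at r within {s..t})" if "r \<in> {s..t}" for r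
  proof -
    have "((\<lambda>r. U (x r)) has_real_derivative u' r) (at r within {t0..})"
      unfolding u'_def using that assms by (intro GDERIV_chain_vector_derivative gradient x_deriv) auto
    from DERIV_diff[OF this DERIV_const[of "Inf (range U)"]] show ?thesis
      unfolding u_def using assms by (auto intro: DERIV_subset)
  qed
  have Z: "(Z has_real_derivative - dissipation r - \<epsilon> r * u' r) (at r within {s..t})" if "r \<in> {s..t}" for r
  proof -
    have r: "r \<ge> t0" using that assms by simp
    have "((\<lambda>r. inner (x' r) (x' r)) has_real_derivative inner (x' r) (x'' r) + inner (x'' r) (x' r)) (at r within {t0..})"
      using bounded_bilinear.has_vector_derivative[OF bounded_bilinear_inner x'_deriv[OF r] x'_deriv[OF r]]
      by (simp add: has_real_derivative_iff_has_vector_derivative)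
    from DERIV_add[OF DERIV_cdivide[OF this, of 2] GDERIV_chain_vector_derivative[OF gradient(1) x_deriv[OF r]]]
    have "(Z has_real_derivative inner (x' r) (x'' r) + inner (x' r) (grad\<Phi> (x r))) (at r within {t0..})"
      unfolding Z_def by (simp add: inner_commute)
    moreover have "x'' r = - (\<gamma> r *\<^sub>R x' r + grad\<Phi> (x r) + \<epsilon> r *\<^sub>R gradU (x r))"
      using ode[OF r] by (simp only: eq_neg_iff_add_eq_0 add.assoc)
    ultimately show ?thesis
      using assms by (auto intro: DERIV_subset simp: u'_def inner_simps power2_norm_eq_inner)
  qed
  have "dissipation integrable_on {s..t}"
    using assms by (intro integrable_continuous_interval continuous_on_subset[OF continuous_dissipation]) auto
  moreover have \<epsilon>: "antimono_on {s..t} \<epsilon>"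
    using \<epsilon>_antimono assms by (rule_tac monotone_on_subset) auto
  note weight = antimono_weight_integral[of s t u u' \<epsilon>, OF \<open>s \<le> t\<close> u _ \<epsilon>]
  have "0 \<le> u r" for r by (simp add: u_def U_ge_Inf)
  then have "(\<lambda>r. \<epsilon> r * u' r) integrable_on {s..t}"
    and eps: "\<epsilon> t * u t - \<epsilon> s * u s \<le> integral {s..t} (\<lambda>r. \<epsilon> r * u' r)"
    using weight by auto
  ultimately have "((\<lambda>r. - dissipation r - \<epsilon> r * u' r) has_integral
      - integral {s..t} dissipation - integral {s..t} (\<lambda>r. \<epsilon> r * u' r)) {s..t}"
    by (intro has_integral_diff has_integral_neg integrable_integral)
  moreover have "((\<lambda>r. - dissipation r - \<epsilon> r * u' r) has_integral Z t - Z s) {s..t}"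
    using Z \<open>s \<le> t\<close>
    by (intro fundamental_theorem_of_calculus) (auto simp flip: has_real_derivative_iff_has_vector_derivative)
  ultimately have "- integral {s..t} dissipation - integral {s..t} (\<lambda>r. \<epsilon> r * u' r) = Z t - Z s"
    by (rule has_integral_unique)
  moreover have "W r = Z r - Inf (range \<Phi>) + \<epsilon> r * u r" for r
    by (simp add: energy_def Z_def u_def power2_norm_eq_inner)
  ultimately show ?thesis using eps by simp
qed

lemma integral_dissipation_bounds:
  assumes "t0 \<le> s" "s \<le> t"
  shows "0 \<le> integral {s..t} dissipation" "integral {s..t} dissipation \<le> W s"
proof -
  show "0 \<le> integral {s..t} dissipation"
    using assms dissipation_nonneg by (intro integral_nonneg integrable_continuous_interval
      continuous_on_subset[OF continuous_dissipation]) auto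
  show "integral {s..t} dissipation \<le> W s"
    using energy_dissipation[OF assms] energy_nonneg[of t] assms by simp
qed

lemma energy_antimono: "\<lbrakk>t0 \<le> s; s \<le> t\<rbrakk> \<Longrightarrow> W t \<le> W s"
  using energy_dissipation[of s t] integral_dissipation_bounds(1)[of s t] by simp

end

section \<open>Distance to a minimizer and the logarithmic bound\<close>

text \<open>Monotonicity of \<open>\<gamma> t + K2 / t\<close> is the integrated form of
  \<open>\<gamma>' \<le> K2 / t^2\<close>. The initial time \<open>T\<close> is a parameter so that
  the estimates can be restarted later, once \<open>\<epsilon>\<close> is small.\<close>

locale slowly_damped_system = inertial_gradient_system +
  fixes T K1 K2 :: real and z :: 'a
  assumes T: "t0 \<le> T" and K1: "0 < K1" and K2: "0 < K2"
    and \<gamma>_ge: "\<And>t. T \<le> t \<Longrightarrow> K1 / t \<le> \<gamma> t"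
    and \<gamma>_antimono: "antimono_on {T..} (\<lambda>t. \<gamma> t + K2 / t)"
    and minimizer: "\<Phi> z = Inf (range \<Phi>)"
begin

definition h :: "real \<Rightarrow> real" where "h t = (norm (x t - z))\<^sup>2 / 2"

definition h' :: "real \<Rightarrow> real" where "h' t = inner (x' t) (x t - z)"

definition h'' :: "real \<Rightarrow> real" where "h'' t = (norm (x' t))\<^sup>2 + inner (x'' t) (x t - z)"

lemma T_pos: "0 < T"
  using T t0 by simp

lemma h_nonneg: "0 \<le> h t"
  by (simp add: h_def)

lemma h_deriv:
  assumes "T \<le> t"
  shows "(h has_real_derivative h' t) (at t within {T..})"
    and "(h' has_real_derivative h'' t) (at t within {T..})"
proof -
  have t: "t0 \<le> t" using assms T by simp
  have *: "((\<lambda>t. x t - z) has_vector_derivative x' t) (at t within {t0..})"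
    using has_vector_derivative_diff[OF x_deriv[OF t] has_vector_derivative_const[of z]] by simp
  have "((\<lambda>t. inner (x t - z) (x t - z)) has_real_derivative inner (x t - z) (x' t) + inner (x' t) (x t - z)) (at t within {t0..})"
    using bounded_bilinear.has_vector_derivative[OF bounded_bilinear_inner * *]
    by (simp add: has_real_derivative_iff_has_vector_derivative)
  from DERIV_cdivide[OF this, of 2] show "(h has_real_derivative h' t) (at t within {T..})"
    using T by (auto simp: h_def[abs_def] h'_def power2_norm_eq_inner inner_commute intro: DERIV_subset)
  have "(h' has_real_derivative inner (x' t) (x' t) + inner (x'' t) (x t - z)) (at t within {t0..})"
    using bounded_bilinear.has_vector_derivative[OF bounded_bilinear_inner x'_deriv[OF t] *]
    by (simp add: has_real_derivative_iff_has_vector_derivative h'_def[abs_def])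
  then show "(h' has_real_derivative h'' t) (at t within {T..})"
    using T by (auto simp: h''_def power2_norm_eq_inner intro: DERIV_subset)
qed

lemma continuous_h: "continuous_on {T..} h" and continuous_h': "continuous_on {T..} h'"
  using h_deriv by (auto intro!: DERIV_continuous_on)

text \<open>Here the lower bound \<open>K1 / t\<close> on the damping enters: it transfers the
  integral bound on the dissipation to the squared speed with weight \<open>1 / t\<close>.\<close>

lemma speed_le_dissipation:
  assumes "T \<le> t"
  shows "(norm (x' t))\<^sup>2 / t \<le> dissipation t / K1"
proof -
  have "K1 / t * (norm (x' t))\<^sup>2 \<le> dissipation t"
    using \<gamma>_ge[OF assms] by (intro mult_right_mono) auto
  then show ?thesis using K1 by (simp add: field_simps)
qed

text \<open>Cauchy-Schwarz, followed by Young's inequality for the product of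
  \<open>t * norm (x' t)\<close> and \<open>norm (x t - z)\<close>. The factor \<open>t\<close>
  balances the two terms so that, after division by \<open>t ^ 3\<close>, each has an integrable
  weight.\<close>

lemma abs_h'_le:
  assumes "T \<le> t"
  shows "\<bar>h' t\<bar> / t\<^sup>2 \<le> (norm (x' t))\<^sup>2 / t / 2 + h t / t ^ 3"
proof -
  have "0 < t" using assms T_pos by simp
  have "\<bar>h' t\<bar> \<le> norm (x' t) * norm (x t - z)"
    unfolding h'_def by (rule Cauchy_Schwarz_ineq2)
  moreover have "t * norm (x' t) * norm (x t - z) \<le> ((t * norm (x' t))\<^sup>2 + (norm (x t - z))\<^sup>2) / 2"
    using zero_le_power2[of "t * norm (x' t) - norm (x t - z)"] by (simp add: power2_diff)
  moreover have "t * \<bar>h' t\<bar> \<le> t * (norm (x' t) * norm (x t - z))"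
    using \<open>0 < t\<close> calculation by (intro mult_left_mono) auto
  ultimately have "t * \<bar>h' t\<bar> \<le> (t * norm (x' t))\<^sup>2 / 2 + h t"
    unfolding h_def
    by (simp add: mult.assoc add_divide_distrib)
  then have "t * \<bar>h' t\<bar> / t ^ 3 \<le> ((t * norm (x' t))\<^sup>2 / 2 + h t) / t ^ 3"
    using \<open>0 < t\<close> by (intro divide_right_mono) auto
  moreover have "t * \<bar>h' t\<bar> / t ^ 3 = \<bar>h' t\<bar> / t\<^sup>2"
    "((t * norm (x' t))\<^sup>2 / 2 + h t) / t ^ 3 = (norm (x' t))\<^sup>2 / t / 2 + h t / t ^ 3"
    using \<open>0 < t\<close> by (simp_all add: power3_eq_cube power2_eq_square field_simps)
  ultimately show ?thesis by simp
qed

lemma continuous_h_cube: "continuous_on {T..} (\<lambda>t. h t / t ^ 3)"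
  using T_pos by (intro continuous_intros continuous_h) auto

text \<open>By Young's inequality, \<open>h / s\<^sup>2\<close> has derivative at most \<open>\<parallel>x'\<parallel>\<^sup>2 / (2 s) - h / s\<^sup>3\<close>.\<close>

lemma hardy_bound:
  assumes "T \<le> t"
  shows "h t / t\<^sup>2 + integral {T..t} (\<lambda>s. h s / s ^ 3) \<le> h T / T\<^sup>2 + W T / (2 * K1)"
proof -
  define R where "R = (\<lambda>t. integral {T..t} (\<lambda>s. h s / s ^ 3))"
  define Q where "Q = (\<lambda>t. integral {T..t} dissipation)"
  \<comment> \<open>The coefficient of \<open>Q\<close> is such that the dissipation absorbs half
    the squared speed divided by \<open>s\<close>.\<close>
  define F where "F = (\<lambda>t. h t / t\<^sup>2 + R t - Q t / (2 * K1))"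
  have "F t \<le> F T"
  proof (rule nonpos_derivative_imp_le[OF _ _ assms])
    fix s assume s: "T \<le> s"
    then have "0 < s" using T_pos by simp
    have cont: "continuous_on {T..} dissipation"
      using T by (intro continuous_on_subset[OF continuous_dissipation]) auto
    have d: "((\<lambda>t. h t / t\<^sup>2) has_real_derivative h' s / s\<^sup>2 - 2 * h s / s ^ 3) (at s within {T..})"
      using \<open>0 < s\<close>
      by (auto intro!: derivative_eq_intros h_deriv[OF s] simp: power2_eq_square power3_eq_cube divide_simps)
        (simp add: algebra_simps)
    show "(F has_real_derivative (h' s / s\<^sup>2 - 2 * h s / s ^ 3 + h s / s ^ 3 - dissipation s / (2 * K1))) (at s within {T..})"
      unfolding F_def
      by (intro DERIV_diff DERIV_add DERIV_cdivide d
          has_real_derivative_integral_atLeast[OF continuous_h_cube s, folded R_def]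
          has_real_derivative_integral_atLeast[OF cont s, folded Q_def])
    have "h' s / s\<^sup>2 \<le> \<bar>h' s\<bar> / s\<^sup>2" by (intro divide_right_mono) auto
    also note abs_h'_le[OF s]
    finally have "h' s / s\<^sup>2 \<le> (norm (x' s))\<^sup>2 / s / 2 + h s / s ^ 3" .
    moreover have "(norm (x' s))\<^sup>2 / s / 2 \<le> dissipation s / (2 * K1)"
      using divide_right_mono[OF speed_le_dissipation[OF s], of 2] by (simp add: mult.commute)
    \<comment> \<open>Here \<open>b\<close> stands for \<open>h s / s ^ 3\<close>: of the two copies
      subtracted in \<open>c\<close>, one cancels the Young term and the other the derivative of
      \<open>R\<close>.\<close>
    moreover have "p - c + b - d \<le> 0" if "p \<le> r + b" "r \<le> d" "c = b + b" for p b c d r :: real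
      using that by linarith
    ultimately show "h' s / s\<^sup>2 - 2 * h s / s ^ 3 + h s / s ^ 3 - dissipation s / (2 * K1) \<le> 0"
      by simp
  qed
  moreover have "integral {T..t} dissipation / (2 * K1) \<le> W T / (2 * K1)"
    using integral_dissipation_bounds(2)[OF T assms] K1 by (intro divide_right_mono) auto
  ultimately show ?thesis by (simp add: F_def R_def Q_def)
qed

text \<open>The equation replaces \<open>x''\<close>, and convexity at \<open>x t\<close> towards
  \<open>z\<close> bounds both gradient terms by differences of values. Writing the potential part
  as \<open>W\<close> minus the kinetic energy raises the coefficient of the squared speed from 1 to
  \<open>3 / 2\<close>.\<close>

lemma h''_le:
  assumes "T \<le> t"
  shows "h'' t + \<gamma> t * h' t \<le> 3 / 2 * (norm (x' t))\<^sup>2 - W t + \<epsilon> t * (U z - Inf (range U))"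
proof -
  have t: "t0 \<le> t" using assms T by simp
  have "x'' t = - (\<gamma> t *\<^sub>R x' t + grad\<Phi> (x t) + \<epsilon> t *\<^sub>R gradU (x t))"
    using ode[OF t] by (simp only: eq_neg_iff_add_eq_0 add.assoc)
  then have "inner (x'' t) (x t - z) = inner (- (\<gamma> t *\<^sub>R x' t + grad\<Phi> (x t) + \<epsilon> t *\<^sub>R gradU (x t))) (x t - z)"
    by simp
  also have "\<dots> = - \<gamma> t * h' t + inner (z - x t) (grad\<Phi> (x t)) + \<epsilon> t * inner (z - x t) (gradU (x t))"
    by (simp add: h'_def inner_simps inner_commute algebra_simps)
  finally have "inner (x'' t) (x t - z) =
    - \<gamma> t * h' t + inner (z - x t) (grad\<Phi> (x t)) + \<epsilon> t * inner (z - x t) (gradU (x t))" .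
  moreover have "inner (z - x t) (grad\<Phi> (x t)) \<le> Inf (range \<Phi>) - \<Phi> (x t)"
    using convex_on_gradient_ineq[OF convex(1) gradient(1), of "x t" z] minimizer by simp
  moreover have "\<epsilon> t * inner (z - x t) (gradU (x t)) \<le> \<epsilon> t * (U z - U (x t))"
    using convex_on_gradient_ineq[OF convex(2) gradient(2), of "x t" z] \<epsilon>_pos[OF t]
    by (intro mult_left_mono) auto
  ultimately show ?thesis
    by (simp add: h''_def energy_def algebra_simps)
qed

text \<open>Under the assumption, \<open>h'' + \<gamma> h'\<close> is at most \<open>3 / 2\<close>
  times the squared speed minus \<open>w\<close>. After division by \<open>t\<close> and
  integration, \<open>w\<close> contributes \<open>w * ln t\<close>, while every other term is
  bounded on the relevant side.\<close>

lemma energy_log_bound: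
  assumes w: "\<And>t. T \<le> t \<Longrightarrow> w + \<epsilon> t * (U z - Inf (range U)) \<le> W t"
  obtains B where "\<And>t. T \<le> t \<Longrightarrow> w * ln t \<le> B"
proof -
  \<comment> \<open>Adding \<open>K2 / t\<close> to the damping makes the weight of
    \<open>h'\<close> nonincreasing, so that its integral can be bounded below.\<close>
  define q where "q = (\<lambda>t. (\<gamma> t + K2 / t) / t)"
  \<comment> \<open>The squared speed over \<open>t\<close> occurs with factor \<open>3 / 2\<close>
    from the inequality for \<open>h''\<close> and \<open>(K2 + 1) / 2\<close> from Young's
    inequality; division by \<open>K1\<close> converts it to dissipation.\<close>
  define a where "a = (3 / 2 + (K2 + 1) / 2) / K1"
  define S where "S = (\<lambda>t. integral {T..t} (\<lambda>s. q s * h' s))"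
  define R where "R = (\<lambda>t. integral {T..t} (\<lambda>s. h s / s ^ 3))"
  define Q where "Q = (\<lambda>t. integral {T..t} dissipation)"
  define F where "F = (\<lambda>t. h' t / t + S t + w * ln t - a * Q t - (K2 + 1) * R t)"
  have "continuous_on {T..} (\<lambda>s. q s * h' s)"
    using T T_pos unfolding q_def
    by (intro continuous_intros continuous_h' continuous_on_subset[OF \<gamma>_cont]) auto
  note deriv_S = has_real_derivative_integral_atLeast[OF this, folded S_def]
  have "continuous_on {T..} dissipation"
    using T by (intro continuous_on_subset[OF continuous_dissipation]) auto
  note deriv_Q = has_real_derivative_integral_atLeast[OF this, folded Q_def]
  note deriv_R = has_real_derivative_integral_atLeast[OF continuous_h_cube, folded R_def]
  have q_antimono: "antimono_on {T..t} q" for t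
  proof (rule monotone_onI)
    fix r s assume "r \<in> {T..t}" "s \<in> {T..t}" "r \<le> s"
    then have "\<gamma> s + K2 / s \<le> \<gamma> r + K2 / r" "0 < \<gamma> r + K2 / r" "0 < r"
      using monotone_onD[OF \<gamma>_antimono, of r s] \<gamma>_pos[of r] K2 T T_pos by (auto intro!: add_pos_pos)
    then show "q s \<le> q r"
      unfolding q_def using \<open>r \<le> s\<close> by (intro frac_le) auto
  qed
  have F: "F t \<le> F T" if "T \<le> t" for t
  proof (rule nonpos_derivative_imp_le[OF _ _ that])
    fix s assume s: "T \<le> s"
    then have "0 < s" using T_pos by simp
    have d: "((\<lambda>t. h' t / t) has_real_derivative h'' s / s - h' s / s\<^sup>2) (at s within {T..})"
      using \<open>0 < s\<close> by (auto intro!: derivative_eq_intros h_deriv[OF s] simp: power2_eq_square divide_simps)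
    have e: "((\<lambda>t. w * ln t) has_real_derivative w / s) (at s within {T..})"
      using \<open>0 < s\<close> by (auto intro!: derivative_eq_intros)
    show "(F has_real_derivative (h'' s / s - h' s / s\<^sup>2 + q s * h' s + w / s
        - a * dissipation s - (K2 + 1) * (h s / s ^ 3))) (at s within {T..})"
      unfolding F_def
      by (intro DERIV_diff DERIV_add DERIV_cmult d e deriv_S deriv_Q deriv_R s)
    have "(h'' s + \<gamma> s * h' s) / s \<le> (3 / 2 * (norm (x' s))\<^sup>2 - w) / s"
      using h''_le[OF s] w[OF s] \<open>0 < s\<close> by (intro divide_right_mono) auto
    then have 1: "h'' s / s + \<gamma> s * h' s / s + w / s \<le> 3 / 2 * ((norm (x' s))\<^sup>2 / s)"
      by (simp add: add_divide_distrib diff_divide_distrib)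
    \<comment> \<open>The factor \<open>K2 - 1\<close> collects the error terms in
      \<open>h' s / s^2\<close>: \<open>K2\<close> from using \<open>q\<close> in place of
      \<open>\<gamma> s / s\<close>, and \<open>- 1\<close> from differentiating
      \<open>h' s / s\<close>. Its sign is unknown.\<close>
    have "(K2 - 1) * h' s \<le> \<bar>K2 - 1\<bar> * \<bar>h' s\<bar>" by (metis abs_ge_self abs_mult)
    also have "\<dots> \<le> (K2 + 1) * \<bar>h' s\<bar>" using K2 by (intro mult_right_mono) auto
    finally have "(K2 - 1) * h' s / s\<^sup>2 \<le> (K2 + 1) * (\<bar>h' s\<bar> / s\<^sup>2)"
      by (simp add: divide_right_mono)
    also have "\<dots> \<le> (K2 + 1) * ((norm (x' s))\<^sup>2 / s / 2 + h s / s ^ 3)"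
      using abs_h'_le[OF s] K2 by (intro mult_left_mono) auto
    finally have 2: "(K2 - 1) * h' s / s\<^sup>2 \<le> (K2 + 1) / 2 * ((norm (x' s))\<^sup>2 / s) + (K2 + 1) * (h s / s ^ 3)"
      by (simp add: algebra_simps)
    have "(3 / 2 + (K2 + 1) / 2) * ((norm (x' s))\<^sup>2 / s) \<le> (3 / 2 + (K2 + 1) / 2) * (dissipation s / K1)"
      using speed_le_dissipation[OF s] K2 by (intro mult_left_mono) auto
    moreover have "a * dissipation s = (3 / 2 + (K2 + 1) / 2) * (dissipation s / K1)"
      by (simp add: a_def)
    ultimately have 3: "3 / 2 * ((norm (x' s))\<^sup>2 / s) + (K2 + 1) / 2 * ((norm (x' s))\<^sup>2 / s) \<le> a * dissipation s"
      by (simp only: distrib_right)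
    have "q s * h' s - h' s / s\<^sup>2 = \<gamma> s * h' s / s + (K2 - 1) * h' s / s\<^sup>2"
      using \<open>0 < s\<close> by (simp add: q_def power2_eq_square field_simps)
    then show "h'' s / s - h' s / s\<^sup>2 + q s * h' s + w / s
        - a * dissipation s - (K2 + 1) * (h s / s ^ 3) \<le> 0"
      using 1 2 3 by linarith
  qed
  define H where "H = h T / T\<^sup>2 + W T / (2 * K1)"
  \<comment> \<open>The summands after \<open>F T\<close> bound, in order,
    \<open>- h' t / t\<close>, \<open>- S t\<close>, \<open>a * Q t\<close> and
    \<open>(K2 + 1) * R t\<close>, uniformly in \<open>t\<close>.\<close>
  have "w * ln t \<le> F T + (W T + H) + q T * h T + a * W T + (K2 + 1) * H" if t: "T \<le> t" for t
  proof -
    have "0 < t" using t T_pos by simp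
    have I: "0 \<le> integral {T..t} (\<lambda>s. h s / s ^ 3)"
      using h_nonneg T_pos by (intro integral_nonneg integrable_continuous_interval
        continuous_on_subset[OF continuous_h_cube]) auto
    have hardy: "h t / t\<^sup>2 + integral {T..t} (\<lambda>s. h s / s ^ 3) \<le> H"
      unfolding H_def by (rule hardy_bound[OF t])
    have "0 \<le> h t / t\<^sup>2" using h_nonneg by simp
    then have "integral {T..t} (\<lambda>s. h s / s ^ 3) \<le> H" "h t / t\<^sup>2 \<le> H" using hardy I by auto
    \<comment> \<open>Multiplied by \<open>t\<close>, the Young estimate controls the boundary term
      \<open>h' t / t\<close> by the kinetic energy, bounded by \<open>W T\<close>, and by
      \<open>h t / t^2\<close>, bounded by \<open>H\<close>.\<close>
    have "t * (\<bar>h' t\<bar> / t\<^sup>2) \<le> t * ((norm (x' t))\<^sup>2 / t / 2 + h t / t ^ 3)"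
      using abs_h'_le[OF t] \<open>0 < t\<close> by (intro mult_left_mono) auto
    then have "\<bar>h' t\<bar> / t \<le> (norm (x' t))\<^sup>2 / 2 + h t / t\<^sup>2"
      using \<open>0 < t\<close> by (simp add: power2_eq_square power3_eq_cube distrib_left)
    moreover have "- h' t / t \<le> \<bar>h' t\<bar> / t" using \<open>0 < t\<close> by (intro divide_right_mono) auto
    moreover have "(norm (x' t))\<^sup>2 / 2 \<le> W T"
      using energy_lower_bounds(1)[of t] energy_antimono[OF T t] T t by simp
    ultimately have 1: "- h' t / t \<le> W T + H" using \<open>h t / t\<^sup>2 \<le> H\<close> by linarith
    have "q t * h t - q T * h T \<le> integral {T..t} (\<lambda>s. q s * h' s)"
    proof (rule antimono_weight_integral(2)[OF t _ h_nonneg q_antimono])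
      show "(h has_real_derivative h' s) (at s within {T..t})" if "s \<in> {T..t}" for s
        using that by (intro DERIV_subset[OF h_deriv(1)]) auto
    qed
    moreover have "0 \<le> q t * h t"
      using \<gamma>_pos[of t] K2 T t \<open>0 < t\<close> h_nonneg[of t] by (simp add: q_def)
    ultimately have 2: "- (q T * h T) \<le> integral {T..t} (\<lambda>s. q s * h' s)" by simp
    have 3: "a * integral {T..t} dissipation \<le> a * W T"
      using integral_dissipation_bounds(2)[OF T t] K1 K2 by (intro mult_left_mono) (auto simp: a_def)
    have 4: "(K2 + 1) * integral {T..t} (\<lambda>s. h s / s ^ 3) \<le> (K2 + 1) * H"
      using \<open>integral {T..t} (\<lambda>s. h s / s ^ 3) \<le> H\<close> K2 by (intro mult_left_mono) auto
    show ?thesis using F[OF t] 1 2 3 4 unfolding F_def S_def R_def Q_def by simp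
  qed
  then show thesis using that by blast
qed

text \<open>Otherwise \<open>w * ln t\<close> would be bounded. The term with
  \<open>\<epsilon>\<close> stays in the statement because the locale does not contain the limit of
  \<open>\<epsilon>\<close>.\<close>

lemma energy_not_bounded_away:
  assumes "0 < w"
  shows "\<exists>t\<ge>T. W t < w + \<epsilon> t * (U z - Inf (range U))"
proof (rule ccontr)
  assume "\<not> ?thesis"
  then have "\<And>t. T \<le> t \<Longrightarrow> w + \<epsilon> t * (U z - Inf (range U)) \<le> W t" by (meson not_less)
  then obtain B where B: "\<And>t. T \<le> t \<Longrightarrow> w * ln t \<le> B" using energy_log_bound by metis
  have "filterlim (\<lambda>t. w * ln t) at_top at_top"
    using \<open>0 < w\<close> by (intro filterlim_tendsto_pos_mult_at_top[OF tendsto_const] ln_at_top)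
  then have "eventually (\<lambda>t. B + 1 \<le> w * ln t \<and> T \<le> t) at_top"
    by (auto simp: filterlim_at_top intro: eventually_conj eventually_ge_at_top)
  then obtain t where "B + 1 \<le> w * ln t" "T \<le> t"
    by (auto dest: eventually_happens)
  then show False using B[of t] by simp
qed

text \<open>As \<open>W\<close> is nonnegative and nonincreasing, one time with small energy
  suffices. Such a time is sought where the \<open>\<epsilon>\<close> term is already below
  \<open>w / 2\<close>.\<close>

lemma energy_tendsto_0:
  assumes "(\<epsilon> \<longlongrightarrow> 0) at_top"
  shows "(W \<longlongrightarrow> 0) at_top"
  unfolding tendsto_iff
proof (intro allI impI)
  fix w :: real assume "0 < w"
  have "((\<lambda>t. \<epsilon> t * (U z - Inf (range U))) \<longlongrightarrow> 0 * (U z - Inf (range U))) at_top"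
    by (intro tendsto_intros assms)
  then have "eventually (\<lambda>t. \<epsilon> t * (U z - Inf (range U)) < w / 2) at_top"
    using order_tendstoD(2)[of _ 0 at_top "w / 2"] \<open>0 < w\<close> by simp
  then obtain S where S: "\<And>t. S \<le> t \<Longrightarrow> \<epsilon> t * (U z - Inf (range U)) < w / 2"
    by (auto simp: eventually_at_top_linorder)
  \<comment> \<open>All locale assumptions persist when the initial time is postponed, so the time
    of small energy can be taken beyond \<open>S\<close>.\<close>
  interpret later: slowly_damped_system \<Phi> U grad\<Phi> gradU \<gamma> \<epsilon> x x' x'' t0 "max S T" K1 K2 z
    using T K1 K2 \<gamma>_ge minimizer monotone_on_subset[OF \<gamma>_antimono, of "{max S T..}"]
    by unfold_locales auto
  obtain t where t: "max S T \<le> t" "W t < w / 2 + \<epsilon> t * (U z - Inf (range U))"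
    using later.energy_not_bounded_away[of "w / 2"] \<open>0 < w\<close> by auto
  have "dist (W s) 0 < w" if "t \<le> s" for s
    using energy_antimono[of t s] energy_nonneg[of s] S[of t] t T that by (simp add: dist_real_def)
  then show "eventually (\<lambda>t. dist (W t) 0 < w) at_top"
    by (auto simp: eventually_at_top_linorder)
qed

end

section \<open>From almost everywhere hypotheses to the limits\<close>

theorem theorem1p2:
  fixes \<Phi> U :: "'a::{real_inner,complete_space} \<Rightarrow> real"
    and grad\<Phi> gradU :: "'a \<Rightarrow> 'a"
    and \<gamma> \<epsilon> :: "real \<Rightarrow> real"
    and x x' x'' :: "real \<Rightarrow> 'a"
    and t0 :: real
  assumes t0: "t0 > 0"
    and convex: "convex_on UNIV \<Phi>" "convex_on UNIV U"
    and gradient: "\<And>z. GDERIV \<Phi> z :> grad\<Phi> z" "\<And>z. GDERIV U z :> gradU z"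
    and C1: "continuous_on UNIV grad\<Phi>" "continuous_on UNIV gradU"
    and bounded_below: "bdd_below (range \<Phi>)" "bdd_below (range U)"
    and argmin_nonempty: "{z. \<Phi> z = Inf (range \<Phi>)} \<noteq> {}"
    and grad_Lipschitz: "lipschitz_on_bounded_sets grad\<Phi>" "lipschitz_on_bounded_sets gradU"
    and \<gamma>_pos: "\<And>t. t \<ge> t0 \<Longrightarrow> \<gamma> t > 0"
    and \<gamma>_AC: "abs_continuous_from t0 \<gamma>"
    and \<gamma>_bounds: "\<exists>t1\<ge>t0. \<exists>K1>0. \<exists>K2>0. AE t in lborel. t \<ge> t1 \<longrightarrow>
          \<gamma> t \<ge> K1 / t \<and> \<gamma> differentiable (at t) \<and> deriv \<gamma> t \<le> K2 / t\<^sup>2"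
    and \<epsilon>_pos: "\<And>t. t \<ge> t0 \<Longrightarrow> \<epsilon> t > 0"
    and \<epsilon>_AC: "abs_continuous_from t0 \<epsilon>"
    and \<epsilon>_nonincreasing: "antimono_on {t0..} \<epsilon>"
    and \<epsilon>_lim: "(\<epsilon> \<longlongrightarrow> 0) at_top"
    and x_C2: "\<And>t. t \<ge> t0 \<Longrightarrow> (x has_vector_derivative x' t) (at t within {t0..})"
      "\<And>t. t \<ge> t0 \<Longrightarrow> (x' has_vector_derivative x'' t) (at t within {t0..})"
      "continuous_on {t0..} x''"
    and ode: "\<And>t. t \<ge> t0 \<Longrightarrow>
          x'' t + \<gamma> t *\<^sub>R x' t + grad\<Phi> (x t) + \<epsilon> t *\<^sub>R gradU (x t) = 0"
  shows "(\<integral>\<^sup>+t\<in>{t0..}. ennreal (\<gamma> t * (norm (x' t))\<^sup>2) \<partial>lborel) < \<infinity>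
    \<and> (energy \<Phi> U \<epsilon> x x' \<longlongrightarrow> 0) at_top
    \<and> (x' \<longlongrightarrow> 0) at_top
    \<and> ((\<lambda>t. \<Phi> (x t)) \<longlongrightarrow> Inf (range \<Phi>)) at_top"
proof -
  have \<gamma>_cont: "continuous_on {t0..} \<gamma>"
    by (rule abs_continuous_from_continuous_on[OF \<gamma>_AC])
  interpret inertial_gradient_system \<Phi> U grad\<Phi> gradU \<gamma> \<epsilon> x x' x'' t0
    by unfold_locales (fact t0 convex gradient bounded_below \<gamma>_pos \<gamma>_cont \<epsilon>_pos \<epsilon>_nonincreasing x_C2 ode)+
  obtain t1 K1 K2 where t1: "t0 \<le> t1" and K: "0 < K1" "0 < K2"
    and AE: "AE t in lborel. t \<ge> t1 \<longrightarrow> \<gamma> t \<ge> K1 / t \<and> \<gamma> differentiable (at t) \<and> deriv \<gamma> t \<le> K2 / t\<^sup>2"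
    using \<gamma>_bounds by blast
  \<comment> \<open>Continuity upgrades the almost everywhere lower bound only strictly to the right
    of \<open>t1\<close>, so the start is moved past it.\<close>
  define T where "T = t1 + 1"
  have T: "t0 \<le> T" "0 < T" using t1 t0 by (auto simp: T_def)
  have \<gamma>_ge: "K1 / t \<le> \<gamma> t" if "T \<le> t" for t
  proof -
    have "continuous_on {t1<..} (\<lambda>t. \<gamma> t - K1 / t)"
      using t0 t1 by (intro continuous_intros continuous_on_subset[OF \<gamma>_cont]) auto
    moreover have "AE t in lborel. t1 \<le> t \<longrightarrow> 0 \<le> \<gamma> t - K1 / t"
      using AE by eventually_elim auto
    ultimately show ?thesis
      using AE_continuous_imp_nonneg[of t1 "\<lambda>t. \<gamma> t - K1 / t" t] that by (simp add: T_def)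
  qed
  have \<gamma>_antimono: "antimono_on {T..} (\<lambda>t. \<gamma> t + K2 / t)"
  proof (rule monotone_onI)
    fix s t assume st: "s \<in> {T..}" "t \<in> {T..}" "s \<le> t"
    \<comment> \<open>The monotone comparison function \<open>- K2 / t\<close> is an antiderivative
      of the upper bound on \<open>\<gamma>'\<close>.\<close>
    have "\<gamma> t - (- K2 / t) \<le> \<gamma> s - (- K2 / s)"
    proof (rule abs_continuous_between_AE_deriv_le[OF \<open>s \<le> t\<close>])
      have "abs_continuous_between t0 t \<gamma>"
        using \<gamma>_AC st T by (simp add: abs_continuous_from_def)
      then show "abs_continuous_between s t \<gamma>"
        using abs_continuous_between_subinterval[of t0 t \<gamma> s t] st T by simp
      show "mono_on {s..t} (\<lambda>t. - K2 / t)"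
        using st T K by (intro mono_onI) (auto intro!: divide_left_mono)
      show "AE r in lborel. r \<in> {s..t} \<longrightarrow>
          (\<exists>D\<le>0. ((\<lambda>t. \<gamma> t - - K2 / t) has_real_derivative D) (at r))"
        using AE
      proof eventually_elim
        case (elim r)
        show ?case
        proof
          assume "r \<in> {s..t}"
          then have r: "t1 \<le> r" "0 < r" using st T by (auto simp: T_def)
          then have "(\<gamma> has_real_derivative deriv \<gamma> r) (at r)" "deriv \<gamma> r \<le> K2 / r\<^sup>2"
            using elim by (auto simp: DERIV_deriv_iff_real_differentiable)
          moreover from this(1) have "((\<lambda>t. \<gamma> t - - K2 / t) has_real_derivative deriv \<gamma> r - K2 / r\<^sup>2) (at r)"
            using r(2) by (auto intro!: derivative_eq_intros simp: power2_eq_square)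
          ultimately show "\<exists>D\<le>0. ((\<lambda>t. \<gamma> t - - K2 / t) has_real_derivative D) (at r)"
            by (intro exI[of _ "deriv \<gamma> r - K2 / r\<^sup>2"]) auto
        qed
      qed
    qed
    then show "\<gamma> t + K2 / t \<le> \<gamma> s + K2 / s" by simp
  qed
  obtain z where z: "\<Phi> z = Inf (range \<Phi>)" using argmin_nonempty by blast
  interpret slowly_damped_system \<Phi> U grad\<Phi> gradU \<gamma> \<epsilon> x x' x'' t0 T K1 K2 z
    by unfold_locales (fact T K \<gamma>_ge \<gamma>_antimono z)+
  have W: "(energy \<Phi> U \<epsilon> x x' \<longlongrightarrow> 0) at_top"
    by (rule energy_tendsto_0[OF \<epsilon>_lim])
  have "(\<integral>\<^sup>+t\<in>{t0..}. ennreal (\<gamma> t * (norm (x' t))\<^sup>2) \<partial>lborel) < \<infinity>"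
    using integral_dissipation_bounds(2)[of t0]
    by (intro nn_integral_atLeast_finite continuous_dissipation dissipation_nonneg) auto
  moreover have "(x' \<longlongrightarrow> 0) at_top"
  proof -
    have "((\<lambda>t. (norm (x' t))\<^sup>2) \<longlongrightarrow> 0) at_top"
    proof (rule tendsto_sandwich[OF _ _ tendsto_const])
      show "((\<lambda>t. 2 * W t) \<longlongrightarrow> 0) at_top" using tendsto_mult_right_zero[OF W] .
      show "eventually (\<lambda>t. (norm (x' t))\<^sup>2 \<le> 2 * W t) at_top"
        using eventually_ge_at_top[of t0] by eventually_elim (use energy_lower_bounds(1) in fastforce)
    qed auto
    from tendsto_real_sqrt[OF this] show ?thesis
      by (auto intro: tendsto_norm_zero_cancel)
  qed
  moreover have "((\<lambda>t. \<Phi> (x t)) \<longlongrightarrow> Inf (range \<Phi>)) at_top"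
  proof (rule tendsto_sandwich[OF _ _ tendsto_const])
    show "((\<lambda>t. Inf (range \<Phi>) + W t) \<longlongrightarrow> Inf (range \<Phi>)) at_top"
      using tendsto_add[OF tendsto_const W, of "Inf (range \<Phi>)"] by simp
    show "eventually (\<lambda>t. \<Phi> (x t) \<le> Inf (range \<Phi>) + W t) at_top"
      using eventually_ge_at_top[of t0] by eventually_elim (use energy_lower_bounds(2) in fastforce)
  qed (simp add: \<Phi>_ge_Inf)
  ultimately show ?thesis using W by blast
qed

end
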